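(* Let $\{X,\phi_i\}$ be a limit space for the finitely semicomponible closed injective system $\{X_i,Y_i,f_i\}$. Then $\{X,\phi_i\}$ is a fundamental limit space if and only if the collection $\{\phi_i(X_i)\}_i$ is a locally finite closed cover of $X$.
   Context: $\mathbb{N}=\{0,1,2,\dots\}$. A closed injective system (CIS) $\{X_i,Y_i,f_i\}$ consists, for each $i\in\mathbb{N}$, of a nonempty topological space $X_i$, a closed subspace $Y_i\subset X_i$ and a closed injective continuous map $f_i:Y_i\to X_{i+1}$. Semicomponibility. Each $f_i$ is semicomponible with itself; put $Y_{i,i}=Y_i$, $f_{i,i}=f_i$. For $j>i$, inductively, $f_i$ and $f_j$ are semicomponible if $f_i$ and $f_{j-1}$ are semicomponible and $f_{i,j-1}(Y_{i,j-1})\cap Y_j\neq\emptyset$; in that case $Y_{i,j}=f_{i,j-1}^{-1}(Y_j)$ and $f_{i,j}:Y_{i,j}\to X_{j+1}$ is $f_{i,j}(y)=f_j(f_{i,j-1}(y))$. The CIS is finitely semicomponible if for every $i\in\mathbb{N}$ there are only finitely many $j\in\mathbb{N}$ such that $f_i$ and $f_j$ (or $f_j$ and $f_i$) are semicomponible. A limit space for the CIS is a topological space $X$ with continuous maps $\phi_i:X_i\to X$ ($i\in\mathbb{N}$) such that: (1) $X=\bigcup_{i}\phi_i(X_i)$; (2) each $\phi_i$ is an embedding (a homeomorphism onto its image); (3) if $i<j$ and $f_i$, $f_{j-1}$ are semicomponible, then $\phi_i(X_i)\cap\phi_j(X_j)=\phi_j(f_{i,j-1}(Y_{i,j-1}))$,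 and whenever $\phi_i(x_i)=\phi_j(x_j)$ with $x_i\in X_i$, $x_j\in X_j$, one has $x_i\in Y_{i,j-1}$ and $x_j=f_{i,j-1}(x_i)$; (4) if $i<j$ and $f_i$, $f_{j-1}$ are not semicomponible, then $\phi_i(X_i)\cap\phi_j(X_j)=\emptyset$. A fundamental limit space is a limit space $\{X,\phi_i\}$ such that $X$ has the weak topology: a subset $A\subset X$ is closed in $X$ if and only if $\phi_i^{-1}(A)$ is closed in $X_i$ for all $i\in\mathbb{N}$. The collection $\{\phi_i(X_i)\}_i$ is locally finite if every point of $X$ has a neighborhood meeting $\phi_i(X_i)$ for only finitely many indices $i$; it is a closed cover if it covers $X$ and each $\phi_i(X_i)$ is closed in $X$. *)

theory Defs
  imports "HOL-Analysis.Analysis"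
begin

text \<open>
  The spaces of a system are topologies \<open>X i\<close> on subsets of one common type \<open>'a\<close>; since the
  carriers \<open>topspace (X i)\<close> are arbitrary (and may overlap without any meaning), a family of
  spaces with unrelated carriers is covered by taking \<open>'a\<close> to be their disjoint union.
\<close>

definition closed_injective_system ::
  "(nat \<Rightarrow> 'a topology) \<Rightarrow> (nat \<Rightarrow> 'a set) \<Rightarrow> (nat \<Rightarrow> 'a \<Rightarrow> 'a) \<Rightarrow> bool" where
  "closed_injective_system X Y f \<longleftrightarrow>
     (\<forall>i. topspace (X i) \<noteq> {} \<and>
          closedin (X i) (Y i) \<and>
          continuous_map (subtopology (X i) (Y i)) (X (Suc i)) (f i) \<and>
          closed_map (subtopology (X i) (Y i)) (X (Suc i)) (f i) \<and>
          inj_on (f i) (Y i))"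

text \<open>
  \<open>comp_map f i j\<close> is $f_{i,j}$ and \<open>comp_dom Y f i j\<close> is $Y_{i,j}$, both for \<open>i \<le> j\<close>.
  They are defined also when $f_i$ and $f_j$ are not semicomponible (then \<open>comp_dom Y f i j\<close> is
  empty); the values for \<open>j < i\<close> are irrelevant.
\<close>

primrec comp_map :: "(nat \<Rightarrow> 'a \<Rightarrow> 'a) \<Rightarrow> nat \<Rightarrow> nat \<Rightarrow> 'a \<Rightarrow> 'a" where
  "comp_map f i 0 = f i"
| "comp_map f i (Suc j) = (if i \<le> j then (\<lambda>y. f (Suc j) (comp_map f i j y)) else f i)"

primrec comp_dom :: "(nat \<Rightarrow> 'a set) \<Rightarrow> (nat \<Rightarrow> 'a \<Rightarrow> 'a) \<Rightarrow> nat \<Rightarrow> nat \<Rightarrow> 'a set" where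
  "comp_dom Y f i 0 = Y i"
| "comp_dom Y f i (Suc j) =
     (if i \<le> j then {y \<in> comp_dom Y f i j. comp_map f i j y \<in> Y (Suc j)} else Y i)"

inductive semicomponible :: "(nat \<Rightarrow> 'a set) \<Rightarrow> (nat \<Rightarrow> 'a \<Rightarrow> 'a) \<Rightarrow> nat \<Rightarrow> nat \<Rightarrow> bool"
  for Y f where
  self: "semicomponible Y f i i"
| step: "semicomponible Y f i j \<Longrightarrow> comp_map f i j ` comp_dom Y f i j \<inter> Y (Suc j) \<noteq> {}
           \<Longrightarrow> semicomponible Y f i (Suc j)"

definition finitely_semicomponible ::
  "(nat \<Rightarrow> 'a set) \<Rightarrow> (nat \<Rightarrow> 'a \<Rightarrow> 'a) \<Rightarrow> bool" where
  "finitely_semicomponible Y f \<longleftrightarrow>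
     (\<forall>i. finite {j. semicomponible Y f i j \<or> semicomponible Y f j i})"

definition limit_space ::
  "(nat \<Rightarrow> 'a topology) \<Rightarrow> (nat \<Rightarrow> 'a set) \<Rightarrow> (nat \<Rightarrow> 'a \<Rightarrow> 'a) \<Rightarrow>
   'b topology \<Rightarrow> (nat \<Rightarrow> 'a \<Rightarrow> 'b) \<Rightarrow> bool" where
  "limit_space X Y f L \<phi> \<longleftrightarrow>
     (\<forall>i. continuous_map (X i) L (\<phi> i)) \<and>
     topspace L = (\<Union>i. \<phi> i ` topspace (X i)) \<and>
     (\<forall>i. embedding_map (X i) L (\<phi> i)) \<and>
     (\<forall>i j. i < j \<and> semicomponible Y f i (j - 1) \<longrightarrow>
        \<phi> i ` topspace (X i) \<inter> \<phi> j ` topspace (X j) =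
          \<phi> j ` comp_map f i (j - 1) ` comp_dom Y f i (j - 1) \<and>
        (\<forall>x \<in> topspace (X i). \<forall>x' \<in> topspace (X j). \<phi> i x = \<phi> j x' \<longrightarrow>
           x \<in> comp_dom Y f i (j - 1) \<and> x' = comp_map f i (j - 1) x)) \<and>
     (\<forall>i j. i < j \<and> \<not> semicomponible Y f i (j - 1) \<longrightarrow>
        \<phi> i ` topspace (X i) \<inter> \<phi> j ` topspace (X j) = {})"

definition fundamental_limit_space ::
  "(nat \<Rightarrow> 'a topology) \<Rightarrow> (nat \<Rightarrow> 'a set) \<Rightarrow> (nat \<Rightarrow> 'a \<Rightarrow> 'a) \<Rightarrow>
   'b topology \<Rightarrow> (nat \<Rightarrow> 'a \<Rightarrow> 'b) \<Rightarrow> bool" where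
  "fundamental_limit_space X Y f L \<phi> \<longleftrightarrow>
     limit_space X Y f L \<phi> \<and>
     (\<forall>A \<subseteq> topspace L.
        closedin L A \<longleftrightarrow> (\<forall>i. closedin (X i) {x \<in> topspace (X i). \<phi> i x \<in> A}))"

text \<open>
  Local finiteness counts indices rather than distinct members, so \<open>locally_finite_in\<close>, which
  speaks about a set of sets, is weaker.
\<close>

definition locally_finite_family :: "'b topology \<Rightarrow> (nat \<Rightarrow> 'b set) \<Rightarrow> bool" where
  "locally_finite_family L C \<longleftrightarrow>
     (\<forall>x \<in> topspace L. \<exists>V. openin L V \<and> x \<in> V \<and> finite {i. C i \<inter> V \<noteq> {}})"

definition closed_cover :: "'b topology \<Rightarrow> (nat \<Rightarrow> 'b set) \<Rightarrow> bool" where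
  "closed_cover L C \<longleftrightarrow> (\<Union>i. C i) = topspace L \<and> (\<forall>i. closedin L (C i))"

end

theory Submission
  imports Defs
begin

text \<open>
  Conditions (3) and (4) describe the preimage of $\phi_j(X_j)$ in $X_i$: it is $Y_{i,j-1}$, the
  image of $f_{j,i-1}$, all of $X_i$ or empty, hence closed in every case. Finite
  semicomponibility says that each $\phi_k(X_k)$ meets only finitely many of the other members.
  For the weak topology the members are therefore closed, and so is the union of those members
  that miss a given point; its complement is a neighbourhood witnessing local finiteness.
  Conversely, a locally finite closed cover by embedded pieces always induces the weak topology,
  because a locally finite union of closed sets is closed.
\<close>

section \<open>Composites of the bonding maps and their domains\<close>

lemma comp_dom_self [simp]: "comp_dom Y f i i = Y i"
  by (cases i) auto

lemma comp_map_self [simp]: "comp_map f i i = f i"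
  by (cases i) auto

text \<open>By induction on \<open>j\<close>, the composites inherit the properties of the single
  maps: the new domain is the preimage of the closed set \<open>Y (Suc j)\<close> under the
  continuous previous composite, and closedness and injectivity pass to compositions.\<close>

lemma closed_injective_system_comp:
  assumes "closed_injective_system X Y f" and "i \<le> j"
  shows "closedin (X i) (comp_dom Y f i j)"
    and "continuous_map (subtopology (X i) (comp_dom Y f i j)) (X (Suc j)) (comp_map f i j)"
    and "closed_map (subtopology (X i) (comp_dom Y f i j)) (X (Suc j)) (comp_map f i j)"
    and "inj_on (comp_map f i j) (comp_dom Y f i j)"
proof -
  have cis: "closedin (X k) (Y k)"
      "continuous_map (subtopology (X k) (Y k)) (X (Suc k)) (f k)"
      "closed_map (subtopology (X k) (Y k)) (X (Suc k)) (f k)"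
      "inj_on (f k) (Y k)" for k
    using assms(1) by (auto simp: closed_injective_system_def)
  have "closedin (X i) (comp_dom Y f i j) \<and>
    continuous_map (subtopology (X i) (comp_dom Y f i j)) (X (Suc j)) (comp_map f i j) \<and>
    closed_map (subtopology (X i) (comp_dom Y f i j)) (X (Suc j)) (comp_map f i j) \<and>
    inj_on (comp_map f i j) (comp_dom Y f i j)"
    using assms(2)
  proof (induction j rule: dec_induct)
    case base
    then show ?case using cis by simp
  next
    case (step j)
    let ?D = "comp_dom Y f i j" and ?D' = "comp_dom Y f i (Suc j)" and ?g = "comp_map f i j"
    have D': "?D' = {y \<in> ?D. ?g y \<in> Y (Suc j)}" and
      g': "comp_map f i (Suc j) = f (Suc j) \<circ> ?g"
      using step.hyps by (auto simp: o_def)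
    have Dtop: "?D \<subseteq> topspace (X i)"
      using step.IH closedin_subset by blast
    \<comment> \<open>Continuity of \<open>f (Suc j)\<close> is given on \<open>Y (Suc j)\<close>,
      so the codomain of \<open>?g\<close> is first cut down to that subspace.\<close>
    have cont: "continuous_map (subtopology (X i) ?D') (subtopology (X (Suc j)) (Y (Suc j))) ?g"
      using step.IH D'
      by (auto simp: continuous_map_in_subtopology
          intro: continuous_map_from_subtopology_mono)
    have "closedin (subtopology (X i) ?D) {y \<in> topspace (subtopology (X i) ?D). ?g y \<in> Y (Suc j)}"
      using step.IH cis(1) closedin_continuous_map_preimage by blast
    moreover have "{y \<in> topspace (subtopology (X i) ?D). ?g y \<in> Y (Suc j)} = ?D'"
      using Dtop unfolding D' by auto
    ultimately have closed: "closedin (X i) ?D'"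
      using step.IH closedin_trans_full by fastforce
    \<comment> \<open>All domains are closed, so closedness in a subspace means closedness in the
      whole space plus containment. This moves \<open>C\<close> from \<open>?D'\<close> to
      \<open>?D\<close>, and its image from \<open>X (Suc j)\<close> into \<open>Y (Suc j)\<close>,
      where the closed maps \<open>?g\<close> and \<open>f (Suc j)\<close> apply.\<close>
    have "closedin (X (Suc (Suc j))) ((f (Suc j) \<circ> ?g) ` C)"
      if C: "closedin (subtopology (X i) ?D') C" for C
    proof -
      have CX: "closedin (X i) C" and CD': "C \<subseteq> ?D'"
        using C closed by (auto simp: closedin_closed_subtopology)
      then have "closedin (subtopology (X i) ?D) C"
        using step.IH D' by (auto simp: closedin_closed_subtopology)
      then have "closedin (X (Suc j)) (?g ` C)"
        using step.IH by (auto simp: closed_map_def)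
      moreover have "?g ` C \<subseteq> Y (Suc j)"
        using CD' D' by auto
      ultimately have "closedin (subtopology (X (Suc j)) (Y (Suc j))) (?g ` C)"
        using cis(1) by (auto simp: closedin_closed_subtopology)
      then show ?thesis
        using cis(3)[of "Suc j"] by (auto simp: closed_map_def image_comp)
    qed
    then have "closed_map (subtopology (X i) ?D') (X (Suc (Suc j))) (f (Suc j) \<circ> ?g)"
      by (simp add: closed_map_def)
    moreover have "inj_on (f (Suc j) \<circ> ?g) ?D'"
      using step.IH cis(4)[of "Suc j"] unfolding D' by (auto simp: inj_on_def)
    ultimately show ?case
      using closed continuous_map_compose[OF cont cis(2)] unfolding g' by blast
  qed
  then show "closedin (X i) (comp_dom Y f i j)"
    "continuous_map (subtopology (X i) (comp_dom Y f i j)) (X (Suc j)) (comp_map f i j)"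
    "closed_map (subtopology (X i) (comp_dom Y f i j)) (X (Suc j)) (comp_map f i j)"
    "inj_on (comp_map f i j) (comp_dom Y f i j)"
    by blast+
qed

section \<open>How the members of a limit space meet\<close>

lemma limit_spaceD:
  assumes "limit_space X Y f L \<phi>"
  shows "continuous_map (X i) L (\<phi> i)"
    and "topspace L = (\<Union>i. \<phi> i ` topspace (X i))"
    and "embedding_map (X i) L (\<phi> i)"
    and "i < j \<Longrightarrow> semicomponible Y f i (j - 1) \<Longrightarrow>
      \<phi> i ` topspace (X i) \<inter> \<phi> j ` topspace (X j) =
        \<phi> j ` comp_map f i (j - 1) ` comp_dom Y f i (j - 1)"
    and "i < j \<Longrightarrow> semicomponible Y f i (j - 1) \<Longrightarrow>
      x \<in> topspace (X i) \<Longrightarrow> x' \<in> topspace (X j) \<Longrightarrow> \<phi> i x = \<phi> j x' \<Longrightarrow>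
      x \<in> comp_dom Y f i (j - 1) \<and> x' = comp_map f i (j - 1) x"
    and "i < j \<Longrightarrow> \<not> semicomponible Y f i (j - 1) \<Longrightarrow>
      \<phi> i ` topspace (X i) \<inter> \<phi> j ` topspace (X j) = {}"
proof -
  note * = assms[unfolded limit_space_def]
  note ** = *[THEN conjunct2, THEN conjunct2, THEN conjunct2]
  note meet = **[THEN conjunct1, THEN spec, THEN spec, THEN mp, OF conjI]
  show "continuous_map (X i) L (\<phi> i)"
    by (rule *[THEN conjunct1, THEN spec])
  show "topspace L = (\<Union>i. \<phi> i ` topspace (X i))"
    by (rule *[THEN conjunct2, THEN conjunct1])
  show "embedding_map (X i) L (\<phi> i)"
    by (rule *[THEN conjunct2, THEN conjunct2, THEN conjunct1, THEN spec])
  show "\<phi> i ` topspace (X i) \<inter> \<phi> j ` topspace (X j) =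
      \<phi> j ` comp_map f i (j - 1) ` comp_dom Y f i (j - 1)"
    if "i < j" "semicomponible Y f i (j - 1)"
    by (rule meet[OF that, THEN conjunct1])
  show "x \<in> comp_dom Y f i (j - 1) \<and> x' = comp_map f i (j - 1) x"
    if "i < j" "semicomponible Y f i (j - 1)"
      and x: "x \<in> topspace (X i)" "x' \<in> topspace (X j)" "\<phi> i x = \<phi> j x'"
    using meet[OF that(1,2), THEN conjunct2] x by blast
  show "\<phi> i ` topspace (X i) \<inter> \<phi> j ` topspace (X j) = {}"
    if "i < j" "\<not> semicomponible Y f i (j - 1)"
    by (rule **[THEN conjunct2, THEN spec, THEN spec, THEN mp, OF conjI, OF that])
qed

text \<open>This is the test that the weak topology applies to the member with index
  \<open>j\<close>. The order of \<open>i\<close> and \<open>j\<close> decides whether the closed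
  set found is the domain or the image of a composite.\<close>

lemma limit_space_closedin_preimage:
  assumes cis: "closed_injective_system X Y f" and lim: "limit_space X Y f L \<phi>"
  shows "closedin (X i) {x \<in> topspace (X i). \<phi> i x \<in> \<phi> j ` topspace (X j)}" (is "closedin _ ?P")
proof (cases i j rule: linorder_cases)
  case equal
  then have "?P = topspace (X i)" by auto
  then show ?thesis by (metis closedin_topspace)
next
  case less
  show ?thesis
  proof (cases "semicomponible Y f i (j - 1)")
    case False
    then have "\<phi> i ` topspace (X i) \<inter> \<phi> j ` topspace (X j) = {}"
      using limit_spaceD(6)[OF lim less] by blast
    then have "?P = {}" by blast
    then show ?thesis by (metis closedin_empty)
  next
    case True
    let ?D = "comp_dom Y f i (j - 1)" and ?g = "comp_map f i (j - 1)"
    have j: "i \<le> j - 1" "Suc (j - 1) = j" using less by auto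
    note comp = closed_injective_system_comp[OF cis j(1), unfolded j(2)]
    have inter: "\<phi> i ` topspace (X i) \<inter> \<phi> j ` topspace (X j) = \<phi> j ` ?g ` ?D"
      and eq: "\<And>x x'. \<lbrakk>x \<in> topspace (X i); x' \<in> topspace (X j); \<phi> i x = \<phi> j x'\<rbrakk>
        \<Longrightarrow> x \<in> ?D \<and> x' = ?g x"
      by (rule limit_spaceD(4)[OF lim less True], rule limit_spaceD(5)[OF lim less True])
    have Dtop: "?D \<subseteq> topspace (X i)"
      using comp(1) closedin_subset by blast
    have gtop: "?g x \<in> topspace (X j)" if "x \<in> ?D" for x
      using comp(2) that Dtop by (auto simp: continuous_map_def)
    \<comment> \<open>Condition (3) does not state \<open>\<phi> i x = \<phi> j (?g x)\<close>
      outright. Its set equality gives \<open>x'\<close> with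
      \<open>\<phi> j (?g x) = \<phi> i x'\<close>, its pointwise clause gives
      \<open>?g x = ?g x'\<close>, and injectivity of \<open>?g\<close> forces
      \<open>x' = x\<close>.\<close>
    have "\<phi> i x \<in> \<phi> j ` topspace (X j)" if x: "x \<in> ?D" for x
    proof -
      obtain x' where x': "x' \<in> topspace (X i)" "\<phi> j (?g x) = \<phi> i x'"
        using inter x by blast
      then have "x' \<in> ?D" "?g x = ?g x'"
        using eq gtop[OF x] by metis+
      then have "x' = x"
        using comp(4) x by (auto simp: inj_on_def)
      then show ?thesis
        using x' gtop[OF x] by (metis image_eqI)
    qed
    then have "?P = ?D"
      using eq Dtop by auto
    then show ?thesis
      using comp(1) by metis
  qed
next
  case greater
  show ?thesis
  proof (cases "semicomponible Y f j (i - 1)")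
    case False
    then have "\<phi> j ` topspace (X j) \<inter> \<phi> i ` topspace (X i) = {}"
      using limit_spaceD(6)[OF lim greater] by blast
    then have "?P = {}" by blast
    then show ?thesis by (metis closedin_empty)
  next
    case True
    let ?D = "comp_dom Y f j (i - 1)" and ?g = "comp_map f j (i - 1)"
    have i: "j \<le> i - 1" "Suc (i - 1) = i" using greater by auto
    note comp = closed_injective_system_comp[OF cis i(1), unfolded i(2)]
    have inter: "\<phi> j ` topspace (X j) \<inter> \<phi> i ` topspace (X i) = \<phi> i ` ?g ` ?D"
      and eq: "\<And>x x'. \<lbrakk>x \<in> topspace (X j); x' \<in> topspace (X i); \<phi> j x = \<phi> i x'\<rbrakk>
        \<Longrightarrow> x \<in> ?D \<and> x' = ?g x"
      by (rule limit_spaceD(4)[OF lim greater True], rule limit_spaceD(5)[OF lim greater True])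
    \<comment> \<open>In this order the preimage consists of values of the composite; it is closed
      because \<open>?g\<close> is a closed map, applied to its whole domain.\<close>
    have closed: "closedin (X i) (?g ` ?D)"
      using comp(1,3) by (simp add: closed_map_def closedin_closed_subtopology)
    have "?P = ?g ` ?D"
    proof
      show "?P \<subseteq> ?g ` ?D"
        using eq by fastforce
      show "?g ` ?D \<subseteq> ?P"
        using inter closedin_subset[OF closed] by blast
    qed
    then show ?thesis
      using closed by metis
  qed
qed

text \<open>By condition (4), a later member \<open>j\<close> can meet member \<open>k\<close> only
  if \<open>k\<close> and \<open>j - 1\<close> are semicomponible, an earlier one only if
  \<open>j\<close> and \<open>k - 1\<close> are. Finite semicomponibility is therefore applied at
  both \<open>k\<close> and \<open>k - 1\<close>.\<close>

lemma limit_space_finite_meets: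
  assumes fin: "finitely_semicomponible Y f" and lim: "limit_space X Y f L \<phi>"
  shows "finite {j. \<phi> k ` topspace (X k) \<inter> \<phi> j ` topspace (X j) \<noteq> {}}"
proof (rule finite_subset)
  note disj = limit_spaceD(6)[OF lim]
  \<comment> \<open>\<open>Suc\<close> undoes the shift \<open>j - 1\<close> for later indices, and
    \<open>insert k\<close> accounts for the member itself. For \<open>k = 0\<close> the truncated
    \<open>k - 1\<close> is harmless, as no index lies below \<open>k\<close>.\<close>
  show "{j. \<phi> k ` topspace (X k) \<inter> \<phi> j ` topspace (X j) \<noteq> {}} \<subseteq>
    insert k (Suc ` {j. semicomponible Y f k j \<or> semicomponible Y f j k} \<union>
      {j. semicomponible Y f (k - 1) j \<or> semicomponible Y f j (k - 1)})"
  proof (rule subsetI, rule ccontr)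
    fix j
    assume "j \<in> {j. \<phi> k ` topspace (X k) \<inter> \<phi> j ` topspace (X j) \<noteq> {}}"
      and no: "j \<notin> insert k (Suc ` {j. semicomponible Y f k j \<or> semicomponible Y f j k} \<union>
        {j. semicomponible Y f (k - 1) j \<or> semicomponible Y f j (k - 1)})"
    then have meets: "\<phi> k ` topspace (X k) \<inter> \<phi> j ` topspace (X j) \<noteq> {}" by simp
    show False
    proof (cases k j rule: linorder_cases)
      case less
      then have "semicomponible Y f k (j - 1)" "j = Suc (j - 1)"
        using disj[OF less] meets by auto
      then show False using no by blast
    next
      case greater
      then show False using disj[OF greater] meets no by blast
    qed (use no in simp)
  qed
  show "finite (insert k (Suc ` {j. semicomponible Y f k j \<or> semicomponible Y f j k} \<union>
      {j. semicomponible Y f (k - 1) j \<or> semicomponible Y f j (k - 1)}))"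
    using fin by (simp add: finitely_semicomponible_def)
qed

section \<open>Local finiteness and the weak topology\<close>

lemma locally_finite_family_weak_topology:
  assumes cover: "topspace L = (\<Union>i. \<phi> i ` topspace (X i))"
    and weak: "\<And>A. A \<subseteq> topspace L \<Longrightarrow>
      (\<And>i. closedin (X i) {x \<in> topspace (X i). \<phi> i x \<in> A}) \<Longrightarrow> closedin L A"
    and preim: "\<And>i j. closedin (X i) {x \<in> topspace (X i). \<phi> i x \<in> \<phi> j ` topspace (X j)}"
    and fin: "\<And>k. finite {j. \<phi> k ` topspace (X k) \<inter> \<phi> j ` topspace (X j) \<noteq> {}}"
  shows "locally_finite_family L (\<lambda>i. \<phi> i ` topspace (X i))"
  unfolding locally_finite_family_def
proof
  let ?C = "\<lambda>i. \<phi> i ` topspace (X i)"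
  fix x assume x: "x \<in> topspace L"
  then obtain k where k: "x \<in> ?C k" using cover by blast
  define B where "B = (\<Union>j \<in> {j. x \<notin> ?C j}. ?C j)"
  have "closedin L B"
  proof (rule weak)
    show "B \<subseteq> topspace L" using cover by (auto simp: B_def)
    fix i
    \<comment> \<open>\<open>B\<close> may be an infinite union, but a member disjoint from member
      \<open>i\<close> has empty preimage in \<open>X i\<close>. Dropping such indices leaves
      \<open>?J\<close>, which is finite by \<open>fin\<close>.\<close>
    let ?J = "{j. x \<notin> ?C j} \<inter> {j. ?C i \<inter> ?C j \<noteq> {}}"
    have "closedin (X i) (\<Union>j \<in> ?J. {y \<in> topspace (X i). \<phi> i y \<in> ?C j})"
      using fin[of i] preim by (intro closedin_Union) auto
    moreover have "{y \<in> topspace (X i). \<phi> i y \<in> B} =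
        (\<Union>j \<in> ?J. {y \<in> topspace (X i). \<phi> i y \<in> ?C j})"
      unfolding B_def by blast
    ultimately show "closedin (X i) {y \<in> topspace (X i). \<phi> i y \<in> B}" by simp
  qed
  then have "openin L (topspace L - B)" by blast
  moreover have "x \<in> topspace L - B" using x by (auto simp: B_def)
  \<comment> \<open>A member not contained in \<open>B\<close> must contain \<open>x\<close>, hence
    meets member \<open>k\<close>.\<close>
  moreover have "{i. ?C i \<inter> (topspace L - B) \<noteq> {}} \<subseteq> {j. ?C k \<inter> ?C j \<noteq> {}}"
    using k unfolding B_def by blast
  then have "finite {i. ?C i \<inter> (topspace L - B) \<noteq> {}}"
    using fin[of k] finite_subset by blast
  ultimately show "\<exists>V. openin L V \<and> x \<in> V \<and> finite {i. ?C i \<inter> V \<noteq> {}}" by blast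
qed

lemma closedin_weak_topology_if_locally_finite:
  assumes emb: "\<And>i. embedding_map (X i) L (\<phi> i)"
    and lf: "locally_finite_family L (\<lambda>i. \<phi> i ` topspace (X i))"
    and cover: "closed_cover L (\<lambda>i. \<phi> i ` topspace (X i))"
    and A: "A \<subseteq> topspace L" "\<And>i. closedin (X i) {x \<in> topspace (X i). \<phi> i x \<in> A}"
  shows "closedin L A"
proof -
  let ?C = "\<lambda>i. \<phi> i ` topspace (X i)"
  have "closedin L (A \<inter> ?C i)" for i
  proof -
    \<comment> \<open>An embedding is a closed map onto its image; closedness in \<open>L\<close>
      follows because the member itself is closed.\<close>
    have "closedin (subtopology L (?C i)) (\<phi> i ` {x \<in> topspace (X i). \<phi> i x \<in> A})"
      using emb A(2) homeomorphic_imp_closed_map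
      unfolding embedding_map_def closed_map_def by blast
    moreover have "\<phi> i ` {x \<in> topspace (X i). \<phi> i x \<in> A} = A \<inter> ?C i" by auto
    ultimately show ?thesis
      using cover closedin_trans_full by (metis closed_cover_def)
  qed
  \<comment> \<open>\<open>locally_finite_in\<close> counts distinct sets; these are images of
    indices, so finiteness of the index set carries over.\<close>
  moreover have "locally_finite_in L (range (\<lambda>i. A \<inter> ?C i))"
    unfolding locally_finite_in_def
  proof (intro conjI ballI)
    fix x assume "x \<in> topspace L"
    then obtain V where V: "openin L V" "x \<in> V" "finite {i. ?C i \<inter> V \<noteq> {}}"
      using lf by (auto simp: locally_finite_family_def)
    have "{U \<in> range (\<lambda>i. A \<inter> ?C i). U \<inter> V \<noteq> {}} \<subseteq> (\<lambda>i. A \<inter> ?C i) ` {i. ?C i \<inter> V \<noteq> {}}"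
      by blast
    then have "finite {U \<in> range (\<lambda>i. A \<inter> ?C i). U \<inter> V \<noteq> {}}"
      using V(3) finite_surj by blast
    then show "\<exists>V. openin L V \<and> x \<in> V \<and> finite {U \<in> range (\<lambda>i. A \<inter> ?C i). U \<inter> V \<noteq> {}}"
      using V by blast
  qed (use A(1) in auto)
  ultimately have "closedin L (\<Union>i. A \<inter> ?C i)"
    by (intro closedin_locally_finite_Union) auto
  moreover have "(\<Union>i. A \<inter> ?C i) = A"
    using A(1) cover unfolding closed_cover_def by blast
  ultimately show ?thesis by simp
qed

theorem corollary11p5:
  fixes X :: "nat \<Rightarrow> 'a topology" and Y :: "nat \<Rightarrow> 'a set" and f :: "nat \<Rightarrow> 'a \<Rightarrow> 'a"
    and L :: "'b topology" and \<phi> :: "nat \<Rightarrow> 'a \<Rightarrow> 'b"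
  assumes "closed_injective_system X Y f"
    and "finitely_semicomponible Y f"
    and "limit_space X Y f L \<phi>"
  shows "fundamental_limit_space X Y f L \<phi> \<longleftrightarrow>
    locally_finite_family L (\<lambda>i. \<phi> i ` topspace (X i)) \<and>
    closed_cover L (\<lambda>i. \<phi> i ` topspace (X i))"
proof -
  note cont = limit_spaceD(1)[OF assms(3)] and cover = limit_spaceD(2)[OF assms(3)]
    and emb = limit_spaceD(3)[OF assms(3)]
  note preim = limit_space_closedin_preimage[OF assms(1,3)]
  note fin = limit_space_finite_meets[OF assms(2,3)]
  show ?thesis
  proof
    assume "fundamental_limit_space X Y f L \<phi>"
    then have weak: "closedin L A"
      if "A \<subseteq> topspace L" "\<And>i. closedin (X i) {x \<in> topspace (X i). \<phi> i x \<in> A}" for A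
      using that unfolding fundamental_limit_space_def by blast
    have "closedin L (\<phi> j ` topspace (X j))" for j
      using weak[of "\<phi> j ` topspace (X j)"] preim cover by blast
    then have "closed_cover L (\<lambda>i. \<phi> i ` topspace (X i))"
      using cover by (simp add: closed_cover_def)
    moreover have "locally_finite_family L (\<lambda>i. \<phi> i ` topspace (X i))"
      by (rule locally_finite_family_weak_topology[OF cover _ preim fin]) (rule weak)
    ultimately show "locally_finite_family L (\<lambda>i. \<phi> i ` topspace (X i)) \<and>
        closed_cover L (\<lambda>i. \<phi> i ` topspace (X i))"
      by blast
  next
    assume *: "locally_finite_family L (\<lambda>i. \<phi> i ` topspace (X i)) \<and>
      closed_cover L (\<lambda>i. \<phi> i ` topspace (X i))"
    show "fundamental_limit_space X Y f L \<phi>"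
      unfolding fundamental_limit_space_def
    proof (intro conjI allI impI iffI)
      \<comment> \<open>The forward half of the criterion is continuity of each
        \<open>\<phi> i\<close>; the locally finite closed cover supplies the converse.\<close>
      show "closedin (X i) {x \<in> topspace (X i). \<phi> i x \<in> A}" if "closedin L A" for A i
        using cont that closedin_continuous_map_preimage by blast
      show "closedin L A" if "A \<subseteq> topspace L"
        "\<forall>i. closedin (X i) {x \<in> topspace (X i). \<phi> i x \<in> A}" for A
        by (rule closedin_weak_topology_if_locally_finite[where X = X and \<phi> = \<phi>])
          (use emb * that in auto)
    qed (rule assms(3))
  qed
qed

end
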